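(* Let $d\ge 1$, $m>1$, $m^\ast:=m/(m-1)$, and let $(b,V)$ satisfy the structural assumptions listed in the context (moderate drift, $\delta=0$) with constants $\rho>0$, $R>0$, $a\in\mathbf{R}$, $\eta>0$. Assume that $\eta>1$ and $a<d-1$. Then $$\lim_{\beta\to\infty}\beta^{\frac{1}{\eta-1}}\left(\frac{\rho^{m^\ast}}{m^\ast}-\lambda_{\max}(\beta)\right)=(\eta-1)\left\{\frac{\rho^{m^\ast-1}}{\eta}(d-1-a)\right\}^{\frac{\eta}{\eta-1}}.$$
   Context: For $r>0$, $B_r:=\{x\in\mathbf{R}^d : |x|<r\}$, and $\overline{B}_r$ is its closure. $D\phi$ and $\Delta\phi$ denote the gradient and Laplacian of $\phi$. For $\beta\ge 0$ consider the equation $$\text{(EP)}\qquad \lambda-\Delta\phi(x)+b(x)\cdot D\phi(x)+\frac1m|D\phi(x)|^m-\beta V(x)=0,\qquad x\in\mathbf{R}^d.$$ A pair $(\lambda,\phi)\in\mathbf{R}\times C^3(\mathbf{R}^d)$ is a subsolution of (EP) if the left-hand side is $\le 0$ for every $x\in\mathbf{R}^d$. The generalized principal eigenvalue is $$\lambda_{\max}(\beta):=\sup\{\lambda\in\mathbf{R} : \text{(EP) has a subsolution } (\lambda,\phi)\in\mathbf{R}\times C^3(\mathbf{R}^d)\}.$$ Structural assumptions on $(b,V)$: $b\in C^2(\mathbf{R}^d,\mathbf{R}^d)$, $V\in C^2(\mathbf{R}^d)$, $DV\in L^\infty(\mathbf{R}^d,\mathbf{R}^d)$, and - $b(x)=(\rho+a|x|^{-1})|x|^{-1}x$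 for all $x\notin B_R$; - $V(x)\ge 0$ for all $x\in\mathbf{R}^d$, $V(x)>0$ for all $x\in\overline{B}_R$, and $V(x)=|x|^{-\eta}$ for all $x\notin B_R$. *)

theory Defs
  imports "HOL-Analysis.Analysis"
begin

text \<open>The space \<open>R^d\<close> is an arbitrary type \<open>'a::euclidean_space\<close> with \<open>d = DIM('a) \<ge> 1\<close>; partial
  derivatives are directional derivatives along the standard orthonormal basis.\<close>

definition partial_deriv ::
  "'a::euclidean_space \<Rightarrow> ('a \<Rightarrow> 'b::real_normed_vector) \<Rightarrow> 'a \<Rightarrow> 'b"
  where "partial_deriv i f x = frechet_derivative f (at x) i"

definition gradient :: "('a::euclidean_space \<Rightarrow> real) \<Rightarrow> 'a \<Rightarrow> 'a"
  where "gradient f x = (\<Sum>i\<in>Basis. partial_deriv i f x *\<^sub>R i)"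

definition laplacian :: "('a::euclidean_space \<Rightarrow> real) \<Rightarrow> 'a \<Rightarrow> real"
  where "laplacian f x = (\<Sum>i\<in>Basis. partial_deriv i (partial_deriv i f) x)"

text \<open>\<open>C_k k f\<close>: \<open>f\<close> is of class \<open>C^k\<close> on the whole space. The explicit differentiability is needed
  because \<open>frechet_derivative\<close> is an arbitrary value where no derivative exists.\<close>

fun C_k :: "nat \<Rightarrow> ('a::euclidean_space \<Rightarrow> 'b::real_normed_vector) \<Rightarrow> bool"
  where
    "C_k 0 f \<longleftrightarrow> continuous_on UNIV f"
  | "C_k (Suc k) f \<longleftrightarrow>
       (\<forall>x. f differentiable (at x)) \<and> (\<forall>i\<in>Basis. C_k k (partial_deriv i f))"

definition L_infinity :: "('a::euclidean_space \<Rightarrow> 'b::real_normed_vector) \<Rightarrow> bool"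
  where "L_infinity f \<longleftrightarrow>
    f \<in> borel_measurable lebesgue \<and> (\<exists>C. AE x in lebesgue. norm (f x) \<le> C)"

definition EP_lhs ::
  "real \<Rightarrow> ('a::euclidean_space \<Rightarrow> 'a) \<Rightarrow> ('a \<Rightarrow> real) \<Rightarrow> real \<Rightarrow> real \<Rightarrow> ('a \<Rightarrow> real) \<Rightarrow> 'a \<Rightarrow> real"
  where "EP_lhs m b V \<beta> l \<phi> x =
    l - laplacian \<phi> x + b x \<bullet> gradient \<phi> x + (1 / m) * norm (gradient \<phi> x) powr m - \<beta> * V x"

definition EP_subsolution ::
  "real \<Rightarrow> ('a::euclidean_space \<Rightarrow> 'a) \<Rightarrow> ('a \<Rightarrow> real) \<Rightarrow> real \<Rightarrow> real \<Rightarrow> ('a \<Rightarrow> real) \<Rightarrow> bool"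
  where "EP_subsolution m b V \<beta> l \<phi> \<longleftrightarrow> C_k 3 \<phi> \<and> (\<forall>x. EP_lhs m b V \<beta> l \<phi> x \<le> 0)"

text \<open>The supremum is taken in \<open>real\<close>. For \<open>m > 1\<close>, \<open>\<beta> \<ge> 0\<close>, \<open>V \<ge> 0\<close> and continuous \<open>b\<close>, \<open>V\<close> the set
  is nonempty (it contains \<open>0\<close>, with constant \<open>\<phi>\<close>) and bounded above (integrate the inequality
  against \<open>\<psi> powr (m / (m - 1))\<close> with a nonnegative test function \<open>\<psi>\<close>).\<close>

definition lambda_max ::
  "real \<Rightarrow> ('a::euclidean_space \<Rightarrow> 'a) \<Rightarrow> ('a \<Rightarrow> real) \<Rightarrow> real \<Rightarrow> real"
  where "lambda_max m b V \<beta> = Sup {l. \<exists>\<phi>. EP_subsolution m b V \<beta> l \<phi>}"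

lemma gderiv_gradient:
  assumes "f differentiable (at x)"
  shows "GDERIV f x :> gradient f x"
proof -
  have D: "(f has_derivative frechet_derivative f (at x)) (at x)"
    using assms by (simp add: frechet_derivative_works)
  then interpret linear "frechet_derivative f (at x)"
    by (rule has_derivative_linear)
  have "frechet_derivative f (at x) = (\<lambda>h. h \<bullet> gradient f x)"
  proof
    fix h
    have "frechet_derivative f (at x) h = frechet_derivative f (at x) (\<Sum>i\<in>Basis. (h \<bullet> i) *\<^sub>R i)"
      by (simp add: euclidean_representation)
    also have "\<dots> = h \<bullet> gradient f x"
      by (simp add: sum scale gradient_def partial_deriv_def inner_sum_right mult.commute)
    finally show "frechet_derivative f (at x) h = h \<bullet> gradient f x" .
  qed
  with D show ?thesis by (simp add: gderiv_def)
qed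

end

theory Submission
  imports Defs
begin

text \<open>
  Write \<open>q = \<rho> powr (mstar - 1)\<close> and \<open>K = q (d - 1 - a) > 0\<close>. Among radial functions the slope \<open>- q\<close>
  minimises \<open>\<rho> p + |p|^m / m\<close>, with value \<open>- \<rho> powr mstar / mstar\<close>, and for this slope the
  remaining terms of the equation at distance \<open>r\<close> are \<open>K / r - \<beta> r powr (- \<eta>)\<close>. Hence the best level is

    \<open>\<rho> powr mstar / mstar - sup\<^sub>r (K / r - \<beta> r powr (- \<eta>))\<close>

  up to lower order. The supremum is attained at \<open>s = (\<eta> \<beta> / K) powr (1 / (\<eta> - 1))\<close>, which tends to
  infinity with \<open>\<beta>\<close>, and equals \<open>K (1 - 1 / \<eta>) / s\<close>; multiplied by \<open>\<beta> powr (1 / (\<eta> - 1))\<close> this is the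
  limit in the theorem. Both bounds are stated in terms of the radius \<open>s\<close> and require errors
  \<open>o(1 / s)\<close>.

  That the eigenvalue is at least this large is seen from the subsolution \<open>- q sqrt (1 + |x|^2)\<close>
  (\<open>subsolution_exists\<close>).

  That it is not larger is a consequence of the maximum principle, applied on the annulus
  \<open>| |x| - s | < \<delta> s\<close> alone. There any subsolution is touched from above by a radial barrier
  that is infinite on the boundary, so its level is at most the supremum of the operator applied to
  the barrier (\<open>subsolution_le_radial_barrier\<close>). The barrier has slope \<open>- q\<close> plus a correction
  \<open>t\<close> that is tiny in the middle of the annulus and diverges at the ends. Its derivative
  has the wrong sign, but near the ends it is dominated by the gap in Young's inequality, which grows like
  \<open>|t|^m\<close> with \<open>m > 1\<close>. As the annulus has width of order \<open>s\<close>, the total cost is \<open>o(1 / s)\<close>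
  (\<open>barrier_excess_small\<close>, \<open>eigenvalue_upper_bound\<close>).
\<close>

section \<open>Comparison with radial barriers\<close>

lemma partial_deriv_eq:
  "(f has_derivative f') (at x) \<Longrightarrow> partial_deriv i f x = f' i"
  by (simp add: partial_deriv_def frechet_derivative_at[symmetric])

lemma gradient_eq:
  fixes f :: "'a::euclidean_space \<Rightarrow> real"
  assumes "(f has_derivative (\<lambda>h. g \<bullet> h)) (at x)"
  shows "gradient f x = g"
  by (simp add: gradient_def partial_deriv_eq[OF assms] euclidean_representation)

lemma laplacian_eq:
  fixes f :: "'a::euclidean_space \<Rightarrow> real"
  assumes f: "\<And>y. (f has_derivative (\<lambda>h. G y \<bullet> h)) (at y)"
    and G: "(G has_derivative G') (at x)"
  shows "laplacian f x = (\<Sum>i\<in>Basis. G' i \<bullet> i)"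
proof -
  have "partial_deriv i (partial_deriv i f) x = G' i \<bullet> i" for i
  proof -
    have "partial_deriv i f = (\<lambda>y. G y \<bullet> i)"
      by (rule ext) (rule partial_deriv_eq[OF f])
    moreover have "((\<lambda>y. G y \<bullet> i) has_derivative (\<lambda>h. G' h \<bullet> i)) (at x)"
      by (intro derivative_intros G)
    ultimately show ?thesis by (simp add: partial_deriv_eq)
  qed
  then show ?thesis by (simp add: laplacian_def)
qed

lemma second_derivative_nonpos_at_local_max:
  fixes g g' :: "real \<Rightarrow> real"
  assumes "e > 0"
    and g: "\<And>t. \<bar>t\<bar> < e \<Longrightarrow> (g has_real_derivative g' t) (at t)"
    and g': "(g' has_real_derivative c) (at 0)"
    and max: "\<And>t. \<bar>t\<bar> < e \<Longrightarrow> g t \<le> g 0"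
  shows "g' 0 = 0" and "c \<le> 0"
proof -
  show 0: "g' 0 = 0"
    using DERIV_local_max[OF g[of 0] \<open>e > 0\<close>] max \<open>e > 0\<close> by auto
  show "c \<le> 0"
  proof (rule ccontr)
    assume "\<not> c \<le> 0"
    with DERIV_pos_inc_right[OF g'] obtain d where
      d: "d > 0" "\<And>h. 0 < h \<Longrightarrow> h < d \<Longrightarrow> g' h > 0"
      by (auto simp: 0)
    \<comment> \<open>half the minimum, so that \<open>s\<close> itself lies in both ranges\<close>
    define s where "s = min d e / 2"
    have s: "0 < s" "s < d" "s < e" using d \<open>e > 0\<close> by (auto simp: s_def)
    have "g 0 < g s"
    proof (rule DERIV_pos_imp_increasing_open[OF s(1)])
      show "\<exists>y. (g has_real_derivative y) (at x) \<and> 0 < y" if "0 < x" "x < s" for x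
        using g[of x] d(2)[of x] that s by (intro exI[of _ "g' x"]) auto
      show "continuous_on {0..s} g"
        using s by (intro DERIV_continuous_on[OF has_field_derivative_at_within[OF g]]) auto
    qed
    with max[of s] s show False by auto
  qed
qed

text \<open>Restricting \<open>\<phi> - \<Phi>\<close> to the coordinate lines through the maximum point reduces both claims to
  the derivative tests in one variable. The barrier \<open>\<Phi>\<close> may be singular away from that point, so it is
  represented by a gradient field \<open>G\<close> on an open set; the trace of \<open>G'\<close> is the Laplacian of \<open>\<Phi>\<close>.\<close>

lemma gradient_laplacian_at_max_of_difference:
  fixes \<phi> \<Phi> :: "'a::euclidean_space \<Rightarrow> real"
  assumes \<phi>: "C_k 3 \<phi>" and "open S" and "x \<in> S"
    and \<Phi>: "\<And>y. y \<in> S \<Longrightarrow> (\<Phi> has_derivative (\<lambda>h. G y \<bullet> h)) (at y)"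
    and G: "(G has_derivative G') (at x)"
    and max: "\<And>y. y \<in> S \<Longrightarrow> \<phi> y - \<Phi> y \<le> \<phi> x - \<Phi> x"
  shows "gradient \<phi> x = G x" and "laplacian \<phi> x \<le> (\<Sum>i\<in>Basis. G' i \<bullet> i)"
proof -
  have key: "partial_deriv i \<phi> x = G x \<bullet> i \<and> partial_deriv i (partial_deriv i \<phi>) x \<le> G' i \<bullet> i"
    if i: "i \<in> Basis" for i
  proof -
    obtain e where e: "e > 0" "ball x e \<subseteq> S"
      using \<open>open S\<close> \<open>x \<in> S\<close> by (meson open_contains_ball)
    have inS: "x + t *\<^sub>R i \<in> S" if "\<bar>t\<bar> < e" for t
      using that e i by (auto simp: dist_norm subset_eq)
    have line: "((\<lambda>t. x + t *\<^sub>R i) has_derivative (\<lambda>s. s *\<^sub>R i)) (at t)" for t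
      by (auto intro!: derivative_eq_intros)
    have d1: "(\<phi> has_derivative frechet_derivative \<phi> (at y)) (at y)" for y
      using \<phi> by (simp add: numeral_3_eq_3 frechet_derivative_works)
    have d2: "(partial_deriv i \<phi> has_derivative frechet_derivative (partial_deriv i \<phi>) (at y)) (at y)" for y
      using \<phi> i by (simp add: numeral_3_eq_3 frechet_derivative_works)
    define g where "g = (\<lambda>t. \<phi> (x + t *\<^sub>R i) - \<Phi> (x + t *\<^sub>R i))"
    define g' where "g' = (\<lambda>t. partial_deriv i \<phi> (x + t *\<^sub>R i) - G (x + t *\<^sub>R i) \<bullet> i)"
    have A: "(g has_real_derivative g' t) (at t)" if "\<bar>t\<bar> < e" for t
    proof -
      have "(g has_derivative (\<lambda>s. frechet_derivative \<phi> (at (x + t *\<^sub>R i)) (s *\<^sub>R i)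
               - G (x + t *\<^sub>R i) \<bullet> (s *\<^sub>R i))) (at t)"
        unfolding g_def
        by (intro has_derivative_diff has_derivative_compose[OF line d1]
            has_derivative_compose[OF line \<Phi>] inS that)
      moreover have "frechet_derivative \<phi> (at y) (s *\<^sub>R i) = s * partial_deriv i \<phi> y" for s y
        using linear_scale[OF has_derivative_linear[OF d1]] by (simp add: partial_deriv_def)
      ultimately show ?thesis
        by (elim has_derivative_imp_has_field_derivative)
          (auto simp: g'_def algebra_simps)
    qed
    have B: "(g' has_real_derivative
        (partial_deriv i (partial_deriv i \<phi>) x - G' i \<bullet> i)) (at 0)"
    proof -
      have G0: "(G has_derivative G') (at (x + 0 *\<^sub>R i))" using G by simp
      have "(g' has_derivative (\<lambda>s. frechet_derivative (partial_deriv i \<phi>) (at (x + 0 *\<^sub>R i)) (s *\<^sub>R i)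
               - G' (s *\<^sub>R i) \<bullet> i)) (at 0)"
        unfolding g'_def
        by (intro has_derivative_diff has_derivative_compose[OF line d2]
            has_derivative_inner_left has_derivative_compose[OF line G0])
      moreover have "frechet_derivative (partial_deriv i \<phi>) (at y) (s *\<^sub>R i)
          = s * partial_deriv i (partial_deriv i \<phi>) y" for s y
        using linear_scale[OF has_derivative_linear[OF d2]] by (simp add: partial_deriv_def)
      ultimately show ?thesis
        using linear_scale[OF has_derivative_linear[OF G]]
        by (elim has_derivative_imp_has_field_derivative) (simp add: algebra_simps)
    qed
    have "g t \<le> g 0" if "\<bar>t\<bar> < e" for t
      using max[OF inS[OF that]] by (simp add: g_def)
    from second_derivative_nonpos_at_local_max[OF e(1) A B this]
    show ?thesis by (simp add: g'_def)
  qed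
  show "gradient \<phi> x = G x"
    by (simp add: gradient_def key euclidean_representation)
  show "laplacian \<phi> x \<le> (\<Sum>i\<in>Basis. G' i \<bullet> i)"
    unfolding laplacian_def using key by (blast intro: sum_mono)
qed

lemma radial_gradient:
  fixes x :: "'a::euclidean_space"
  assumes "x \<noteq> 0" and "(f has_real_derivative f1) (at (norm x))"
  shows "((\<lambda>y. f (norm y)) has_derivative (\<lambda>h. ((f1 / norm x) *\<^sub>R x) \<bullet> h)) (at x)"
proof -
  have "((\<lambda>y. f (norm y)) has_derivative (\<lambda>h. f1 * (h \<bullet> sgn x))) (at x)"
    using has_derivative_compose[OF has_derivative_norm[OF assms(1)]
      assms(2)[unfolded has_field_derivative_def]] by simp
  moreover have "f1 * (h \<bullet> sgn x) = ((f1 / norm x) *\<^sub>R x) \<bullet> h" for h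
    by (simp add: sgn_div_norm inner_commute[of h] divide_inverse)
  ultimately show ?thesis by simp
qed

text \<open>The derivative of \<open>(f1 |y| / |y|) y\<close> is a multiple of the identity plus a rank-one map in the radial
  direction: the identity contributes \<open>d f1 / r\<close> to the trace, the rank-one part \<open>f2 - f1 / r\<close>.\<close>

lemma radial_divergence:
  fixes x :: "'a::euclidean_space"
  assumes x: "x \<noteq> 0" and f1: "(f1 has_real_derivative f2) (at (norm x))"
  obtains G' where "((\<lambda>y. (f1 (norm y) / norm y) *\<^sub>R y) has_derivative G') (at x)"
    and "(\<Sum>i\<in>Basis. G' i \<bullet> i) = f2 + (real DIM('a) - 1) * f1 (norm x) / norm x"
proof
  define r where "r = norm x"
  have r: "r > 0" using x by (simp add: r_def)
  define c where "c = (f2 * r - f1 r) / r\<^sup>2"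
  have c: "((\<lambda>s. f1 s / s) has_real_derivative c) (at (norm x))"
    using f1 r unfolding r_def[symmetric] c_def
    by (auto intro!: derivative_eq_intros simp: power2_eq_square)
  define G' where "G' = (\<lambda>h. ((c / r) * (x \<bullet> h)) *\<^sub>R x + (f1 r / r) *\<^sub>R h)"
  show "((\<lambda>y. (f1 (norm y) / norm y) *\<^sub>R y) has_derivative G') (at x)"
    unfolding G'_def
    by (rule has_derivative_eq_rhs[OF has_derivative_scaleR[OF radial_gradient[OF x c] has_derivative_ident]])
      (simp add: r_def fun_eq_iff add.commute)
  have "(\<Sum>i\<in>Basis. G' i \<bullet> i) = (c / r) * (\<Sum>i\<in>Basis. (x \<bullet> i) * (x \<bullet> i)) + real DIM('a) * (f1 r / r)"
    by (simp add: G'_def inner_add_left sum.distrib sum_distrib_left mult.assoc)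
  also have "(\<Sum>i\<in>Basis. (x \<bullet> i) * (x \<bullet> i)) = r\<^sup>2"
    unfolding euclidean_inner[symmetric] by (simp add: r_def dot_square_norm)
  also have "(c / r) * r\<^sup>2 + real DIM('a) * (f1 r / r) = f2 + (real DIM('a) - 1) * f1 r / r"
    using r by (simp add: c_def field_simps power2_eq_square)
  finally show "(\<Sum>i\<in>Basis. G' i \<bullet> i) = f2 + (real DIM('a) - 1) * f1 (norm x) / norm x"
    by (simp add: r_def)
qed

text \<open>A barrier that tends to infinity at both boundary spheres of an annulus lies above \<open>\<phi>\<close> plus a
  constant and touches it at an interior point, whatever the size of \<open>\<phi>\<close>. At the touching point the
  gradients agree and the Laplacians are ordered, so the inequality for \<open>\<phi>\<close> turns into a bound for
  \<open>l\<close> by the operator applied to the barrier.\<close>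

lemma subsolution_le_radial_barrier:
  fixes b :: "'a::euclidean_space \<Rightarrow> 'a"
  assumes sub: "EP_subsolution m b V \<beta> l \<phi>" and r: "0 \<le> r1" "r1 < r2"
    and f: "\<And>r. r1 < r \<Longrightarrow> r < r2 \<Longrightarrow> (f has_real_derivative f1 r) (at r)"
    and f1: "\<And>r. r1 < r \<Longrightarrow> r < r2 \<Longrightarrow> (f1 has_real_derivative f2 r) (at r)"
    and left: "filterlim f at_top (at_right r1)" and right: "filterlim f at_top (at_left r2)"
  obtains x where "r1 < norm x" "norm x < r2"
    "l \<le> f2 (norm x) + (real DIM('a) - 1) * f1 (norm x) / norm x
       - b x \<bullet> ((f1 (norm x) / norm x) *\<^sub>R x) - \<bar>f1 (norm x)\<bar> powr m / m + \<beta> * V x"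
proof -
  have \<phi>: "C_k 3 \<phi>" and lhs: "\<And>x. EP_lhs m b V \<beta> l \<phi> x \<le> 0"
    using sub by (auto simp: EP_subsolution_def)
  have cont: "continuous_on X \<phi>" for X
    using \<phi> by (auto simp: numeral_3_eq_3 intro!: continuous_at_imp_continuous_on
        differentiable_imp_continuous_within)
  obtain M where M: "\<And>x. x \<in> cball 0 r2 \<Longrightarrow> \<phi> x \<le> M"
    using continuous_attains_sup[OF compact_cball _ cont, of 0 r2] r by force
  \<comment> \<open>a reference point: near the boundary spheres \<open>\<phi> - f\<close> is below its value there, so the maximum is inside\<close>
  obtain x1 :: 'a where x1: "norm x1 = (r1 + r2) / 2"
    using vector_choose_size[of "(r1 + r2) / 2"] r by auto
  define u where "u = (\<lambda>x. \<phi> x - f (norm x))"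
  have "eventually (\<lambda>r. f r \<ge> M - u x1) (at_right r1)"
    using left by (simp add: filterlim_at_top)
  then obtain s1 where s1: "s1 > r1" "\<And>r. r1 < r \<Longrightarrow> r < s1 \<Longrightarrow> f r \<ge> M - u x1"
    by (auto simp: eventually_at_right_field)
  have "eventually (\<lambda>r. f r \<ge> M - u x1) (at_left r2)"
    using right by (simp add: filterlim_at_top)
  then obtain s2 where s2: "s2 < r2" "\<And>r. s2 < r \<Longrightarrow> r < r2 \<Longrightarrow> f r \<ge> M - u x1"
    by (auto simp: eventually_at_left_field)
  define t1 where "t1 = min s1 ((r1 + r2) / 2)"
  define t2 where "t2 = max s2 ((r1 + r2) / 2)"
  have t: "r1 < t1" "t2 < r2" using s1 s2 r by (auto simp: t1_def t2_def)
  define C where "C = cball (0::'a) t2 - ball 0 t1"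
  have C: "x \<in> C \<longleftrightarrow> t1 \<le> norm x \<and> norm x \<le> t2" for x by (auto simp: C_def)
  have "compact C" unfolding C_def by (intro compact_diff) auto
  moreover have "x1 \<in> C" by (auto simp: C x1 t1_def t2_def min_def max_def)
  moreover have "continuous_on C u"
    unfolding u_def
  proof (intro continuous_intros cont)
    have "continuous_on {t1..t2} f"
      using t by (intro DERIV_continuous_on[OF has_field_derivative_at_within[OF f]]) auto
    then show "continuous_on C (\<lambda>x. f (norm x))"
      by (rule continuous_on_compose2) (auto simp: C intro!: continuous_intros)
  qed
  ultimately obtain x where x: "x \<in> C" "\<And>y. y \<in> C \<Longrightarrow> u y \<le> u x"
    using continuous_attains_sup[of C u] by blast
  define S where "S = ball (0::'a) r2 - cball 0 r1"
  have S: "y \<in> S \<longleftrightarrow> r1 < norm y \<and> norm y < r2" for y by (auto simp: S_def)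
  have "open S" unfolding S_def by (intro open_Diff) auto
  have "x \<in> S" using x t by (auto simp: S C)
  have max: "u y \<le> u x" if "y \<in> S" for y
  proof (cases "y \<in> C")
    case False
    then have "f (norm y) \<ge> M - u x1"
      using that s1(2)[of "norm y"] s2(2)[of "norm y"] by (auto simp: C S t1_def t2_def)
    moreover have "\<phi> y \<le> M" using M that by (auto simp: S)
    ultimately have "u y \<le> u x1" by (simp add: u_def)
    then show ?thesis using x(2)[OF \<open>x1 \<in> C\<close>] by simp
  qed (use x in auto)
  have x0: "x \<noteq> 0" using \<open>x \<in> S\<close> r by (auto simp: S)
  obtain G' where G': "((\<lambda>y. (f1 (norm y) / norm y) *\<^sub>R y) has_derivative G') (at x)"
    "(\<Sum>i\<in>Basis. G' i \<bullet> i) = f2 (norm x) + (real DIM('a) - 1) * f1 (norm x) / norm x"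
    using radial_divergence[OF x0 f1] \<open>x \<in> S\<close> by (auto simp: S)
  have D: "((\<lambda>y. f (norm y)) has_derivative (\<lambda>h. ((f1 (norm y) / norm y) *\<^sub>R y) \<bullet> h)) (at y)"
    if "y \<in> S" for y
    using that r by (intro radial_gradient f) (auto simp: S)
  note touch = gradient_laplacian_at_max_of_difference[OF \<phi> \<open>open S\<close> \<open>x \<in> S\<close> D G'(1) max[unfolded u_def]]
  have grad: "gradient \<phi> x = (f1 (norm x) / norm x) *\<^sub>R x" by (rule touch(1))
  show ?thesis
  proof
    show "r1 < norm x" "norm x < r2" using \<open>x \<in> S\<close> by (auto simp: S)
    show "l \<le> f2 (norm x) + (real DIM('a) - 1) * f1 (norm x) / norm x
       - b x \<bullet> ((f1 (norm x) / norm x) *\<^sub>R x) - \<bar>f1 (norm x)\<bar> powr m / m + \<beta> * V x"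
      using lhs[of x] touch(2) x0 unfolding EP_lhs_def grad G'(2) by simp
  qed
qed

section \<open>Smoothness of powers of the Japanese bracket\<close>

lemma C_k_SucD: "C_k (Suc k) f \<Longrightarrow> C_k k f"
proof (induction k arbitrary: f)
  case 0
  then show ?case
    by (auto intro!: continuous_at_imp_continuous_on differentiable_imp_continuous_within)
qed simp

lemma C_k_const: "C_k k (\<lambda>x. c)"
proof (induction k arbitrary: c)
  case (Suc k)
  have "partial_deriv i (\<lambda>x. c) = (\<lambda>x. 0)" for i :: 'a
    by (rule ext) (rule partial_deriv_eq[OF has_derivative_const])
  then show ?case using Suc by simp
qed simp

lemma C_k_inner: "C_k k (\<lambda>x. x \<bullet> v)"
proof (cases k)
  case (Suc n)
  have d: "((\<lambda>x. x \<bullet> v) has_derivative (\<lambda>h. h \<bullet> v)) (at x)" for x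
    by (intro derivative_intros)
  have "partial_deriv i (\<lambda>x. x \<bullet> v) = (\<lambda>x. i \<bullet> v)" for i
    by (rule ext) (rule partial_deriv_eq[OF d])
  then show ?thesis using d Suc by (auto simp: C_k_const differentiable_def)
qed (simp add: continuous_intros)

lemma C_k_add:
  "C_k k f \<Longrightarrow> C_k k g \<Longrightarrow> C_k k (\<lambda>x. f x + g x)"
proof (induction k arbitrary: f g)
  case (Suc k)
  have "partial_deriv i (\<lambda>x. f x + g x) = (\<lambda>x. partial_deriv i f x + partial_deriv i g x)" for i
    using Suc.prems
    by (auto simp: partial_deriv_def frechet_derivative_works
        intro!: ext partial_deriv_eq[unfolded partial_deriv_def] has_derivative_add)
  then show ?case using Suc by auto
qed (simp add: continuous_intros)

lemma C_k_mult:
  fixes f g :: "'a::euclidean_space \<Rightarrow> real"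
  shows "C_k k f \<Longrightarrow> C_k k g \<Longrightarrow> C_k k (\<lambda>x. f x * g x)"
proof (induction k arbitrary: f g)
  case (Suc k)
  have "partial_deriv i (\<lambda>x. f x * g x) =
      (\<lambda>x. f x * partial_deriv i g x + partial_deriv i f x * g x)" for i
    using Suc.prems
    by (auto simp: partial_deriv_def frechet_derivative_works
        intro!: ext partial_deriv_eq[unfolded partial_deriv_def] has_derivative_mult)
  moreover have "C_k k f" "C_k k g" using Suc.prems by (auto intro: C_k_SucD)
  ultimately show ?case using Suc by (auto intro!: C_k_add)
qed (simp add: continuous_intros)

lemma japanese_bracket_pos: "0 < 1 + x \<bullet> (x::'a::real_inner)"
  by (simp add: add_pos_nonneg)

lemma has_derivative_japanese_bracket_powr:
  fixes x :: "'a::euclidean_space"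
  shows "((\<lambda>y::'a. (1 + y \<bullet> y) powr p) has_derivative
    (\<lambda>h. ((2 * p * (1 + x \<bullet> x) powr (p - 1)) *\<^sub>R x) \<bullet> h)) (at x)"
proof -
  have "((\<lambda>s. s powr p) has_derivative (\<lambda>s. p * (1 + x \<bullet> x) powr (p - 1) * s)) (at (1 + x \<bullet> x))"
    using has_real_derivative_powr[OF japanese_bracket_pos[of x], of p]
    by (simp add: has_field_derivative_def)
  moreover have "((\<lambda>y. 1 + y \<bullet> y) has_derivative (\<lambda>h. 2 * (x \<bullet> h))) (at x)"
    by (auto intro!: derivative_eq_intros simp: inner_commute)
  ultimately show ?thesis
    by (auto dest: has_derivative_compose simp: mult_ac)
qed

text \<open>The exponent is arbitrary in the induction because each partial derivative lowers it by one and
  multiplies by a linear function.\<close>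

lemma C_k_japanese_bracket_powr:
  "C_k k (\<lambda>x::'a::euclidean_space. (1 + x \<bullet> x) powr p)"
proof (induction k arbitrary: p)
  case 0
  show ?case
    using has_derivative_japanese_bracket_powr[where 'a='a, of p]
    by (auto intro!: continuous_at_imp_continuous_on has_derivative_continuous)
next
  case (Suc k)
  have "partial_deriv i (\<lambda>x::'a. (1 + x \<bullet> x) powr p)
      = (\<lambda>x. (2 * p) * ((1 + x \<bullet> x) powr (p - 1) * (x \<bullet> i)))" for i
    by (rule ext) (subst partial_deriv_eq[OF has_derivative_japanese_bracket_powr], simp)
  moreover have "C_k k (\<lambda>x::'a. (2 * p) * ((1 + x \<bullet> x) powr (p - 1) * (x \<bullet> i)))" for i
    by (intro C_k_mult C_k_const C_k_inner Suc.IH)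
  moreover have "(\<lambda>x::'a. (1 + x \<bullet> x) powr p) differentiable (at x)" for x
    using has_derivative_japanese_bracket_powr by (rule differentiableI)
  ultimately show ?case by simp
qed

section \<open>The gap in Young's inequality\<close>

lemma bernoulli_powr_strict:
  fixes m t :: real
  assumes m: "m > 1" and t: "t > 0" "t \<noteq> 1"
  shows "1 + m * (t - 1) < t powr m"
proof -
  define g where "g = (\<lambda>t. t powr m - m * t)"
  have d: "(g has_real_derivative m * (s powr (m - 1) - 1)) (at s)" if "s > 0" for s
    unfolding g_def using that by (auto intro!: derivative_eq_intros simp: algebra_simps)
  have cont: "continuous_on {u..v} g" if "u > 0" for u v
    using that by (intro DERIV_continuous_on[OF has_field_derivative_at_within[OF d]]) auto
  have "g 1 < g t"
  proof (cases "t > 1")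
    case True
    show ?thesis
    proof (rule DERIV_pos_imp_increasing_open[OF True _ cont])
      fix s assume "1 < s" "s < t"
      then show "\<exists>y. (g has_real_derivative y) (at s) \<and> 0 < y"
        using d[of s] m gr_one_powr[of s "m - 1"] by (intro exI conjI) auto
    qed simp
  next
    case False
    with t have lt: "t < 1" by simp
    show ?thesis
    proof (rule DERIV_neg_imp_decreasing_open[OF lt _ cont])
      fix s assume s: "t < s" "s < 1"
      then have "s powr (m - 1) < 1"
        using powr_less_mono2[of "m - 1" s 1] m t by simp
      then show "\<exists>y. (g has_real_derivative y) (at s) \<and> y < 0"
        using d[of s] m t s by (intro exI conjI) (auto simp: mult_less_0_iff)
    qed (use t in simp)
  qed
  then show ?thesis by (simp add: g_def algebra_simps)
qed

lemma bernoulli_powr: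
  fixes m t :: real
  assumes "m > 1" "t > 0"
  shows "1 + m * (t - 1) \<le> t powr m"
  using bernoulli_powr_strict[OF assms] by (cases "t = 1") auto

text \<open>With \<open>\<rho> = q powr (m - 1)\<close> and \<open>m' = m / (m - 1)\<close> this is \<open>|p|^m / m - \<rho> p + \<rho>^m' / m'\<close>, the
  amount by which \<open>p\<close> misses equality in Young's inequality; equality holds at \<open>p = q\<close> alone.\<close>

definition young_gap :: "real \<Rightarrow> real \<Rightarrow> real \<Rightarrow> real"
  where "young_gap m q p = \<bar>p\<bar> powr m / m - q powr (m - 1) * p + q powr m * (1 - 1 / m)"

text \<open>For \<open>p > 0\<close> this is Bernoulli's inequality for \<open>p / q\<close>, multiplied by \<open>q powr m / m\<close>.\<close>

lemma young_gap_pos: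
  assumes m: "m > 1" and q: "q > 0" and p: "p \<noteq> q"
  shows "young_gap m q p > 0"
proof (cases "p > 0")
  case True
  have "1 + m * (p / q - 1) < (p / q) powr m"
    using True p q by (intro bernoulli_powr_strict m) auto
  then have "q powr m * (1 + m * (p / q - 1)) < q powr m * (p / q) powr m"
    using q by simp
  also have "\<dots> = p powr m" using True q by (simp add: powr_divide)
  finally have *: "q powr m * (1 + m * (p / q - 1)) < p powr m" .
  have "q powr m = q * q powr (m - 1)" using q by (simp add: powr_diff)
  then have "q powr m * (1 + m * (p / q - 1)) / m = q powr (m - 1) * p - q powr m * (1 - 1 / m)"
    using q m by (simp add: field_simps)
  with divide_strict_right_mono[OF *, of m] m True show ?thesis by (simp add: young_gap_def)
next
  case False
  then have "- (q powr (m - 1) * p) \<ge> 0" by (simp add: mult_nonneg_nonpos)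
  moreover have "q powr m * (1 - 1 / m) > 0" using m q by (intro mult_pos_pos) auto
  moreover have "\<bar>p\<bar> powr m / m \<ge> 0" using m by simp
  ultimately show ?thesis unfolding young_gap_def by linarith
qed

lemma young_gap_nonneg:
  assumes "m > 1" "q > 0"
  shows "young_gap m q p \<ge> 0"
proof (cases "p = q")
  case True
  have "q powr m = q * q powr (m - 1)" using assms by (simp add: powr_diff)
  with True assms show ?thesis by (simp add: young_gap_def field_simps)
qed (use young_gap_pos[OF assms] in \<open>simp add: less_imp_le\<close>)

text \<open>Away from its zero the gap grows like the full power \<open>|s|^m\<close>: for large \<open>s\<close> the linear term is
  absorbed by half of the leading power, and on the compact range that remains the quotient of the
  two sides has a positive minimum.\<close>

lemma young_gap_coercive:
  assumes m: "m > 1" and q: "q > 0" and A: "A > 0"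
  obtains \<kappa> where "\<kappa> > 0" "\<And>s. \<bar>s\<bar> \<ge> A \<Longrightarrow> \<kappa> * \<bar>s\<bar> powr m \<le> young_gap m q (q + s)"
proof -
  define c where "c = q powr (m - 1)"
  \<comment> \<open>the power in \<open>P\<close> is the point beyond which \<open>2 m c p \<le> p powr m\<close>; the extra \<open>q\<close> gives \<open>|s| \<le> 2 |q + s|\<close>\<close>
  define P where "P = (2 * m * c) powr (1 / (m - 1)) + q"
  define S where "S = max (P + q) A"
  define \<kappa>1 where "\<kappa>1 = 1 / (2 * m * 2 powr m)"
  have c: "c > 0" using q by (simp add: c_def)
  have P: "P \<ge> q" by (simp add: P_def)
  have \<kappa>1: "\<kappa>1 > 0" using m by (simp add: \<kappa>1_def)
  have far: "\<kappa>1 * \<bar>s\<bar> powr m \<le> young_gap m q (q + s)" if "\<bar>s\<bar> \<ge> S" for s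
  proof -
    define p where "p = \<bar>q + s\<bar>"
    have p: "p \<ge> P" "p > 0" using that q P by (auto simp: S_def p_def)
    have "2 * m * c = ((2 * m * c) powr (1 / (m - 1))) powr (m - 1)"
      using m c by (simp add: powr_powr)
    also have "\<dots> \<le> p powr (m - 1)"
      using p m q by (intro powr_mono2) (auto simp: P_def)
    finally have "2 * m * c * p \<le> p powr (m - 1) * p" using p by (intro mult_right_mono) auto
    also have "\<dots> = p powr m" using p by (simp add: powr_diff)
    finally have 1: "c * p \<le> p powr m / (2 * m)" using m by (simp add: field_simps)
    have "c * (q + s) \<le> c * p" using c by (intro mult_left_mono) (auto simp: p_def)
    moreover have "q powr m * (1 - 1 / m) \<ge> 0" using m by simp
    moreover have "p powr m / m = p powr m / (2 * m) + p powr m / (2 * m)" by simp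
    ultimately have "p powr m / (2 * m) \<le> young_gap m q (q + s)"
      using 1 unfolding young_gap_def c_def[symmetric] p_def[symmetric] by linarith
    moreover have "\<bar>s\<bar> \<le> 2 * p" using p P q abs_triangle_ineq[of "q + s" "- q"] unfolding p_def by simp
    then have "\<bar>s\<bar> powr m \<le> (2 * p) powr m" using m by (intro powr_mono2) auto
    then have "\<kappa>1 * \<bar>s\<bar> powr m \<le> \<kappa>1 * (2 * p) powr m" using \<kappa>1 by simp
    moreover have "\<kappa>1 * (2 * p) powr m = p powr m / (2 * m)"
      using p by (simp add: \<kappa>1_def powr_mult)
    ultimately show ?thesis by simp
  qed
  define g where "g = (\<lambda>s. young_gap m q (q + s) / \<bar>s\<bar> powr m)"
  define C where "C = cball 0 S - ball (0::real) A"
  have C: "s \<in> C \<longleftrightarrow> A \<le> \<bar>s\<bar> \<and> \<bar>s\<bar> \<le> S" for s by (auto simp: C_def)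
  have "compact C" unfolding C_def by (intro compact_diff) auto
  moreover have "A \<in> C" using A by (auto simp: C S_def)
  moreover have "continuous_on C g"
    unfolding g_def young_gap_def using A m
    by (intro continuous_intros continuous_on_powr') (auto simp: C)
  ultimately obtain s0 where s0: "s0 \<in> C" "\<And>s. s \<in> C \<Longrightarrow> g s0 \<le> g s"
    using continuous_attains_inf[of C g] by blast
  have "g s0 > 0"
    using s0(1) A young_gap_pos[OF m q, of "q + s0"] by (auto simp: g_def C)
  have near: "g s0 * \<bar>s\<bar> powr m \<le> young_gap m q (q + s)" if "A \<le> \<bar>s\<bar>" "\<bar>s\<bar> \<le> S" for s
    using s0(2)[of s] that A by (simp add: g_def C pos_le_divide_eq)
  show ?thesis
  proof
    show "min \<kappa>1 (g s0) > 0" using \<kappa>1 \<open>g s0 > 0\<close> by simp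
    show "min \<kappa>1 (g s0) * \<bar>s\<bar> powr m \<le> young_gap m q (q + s)" if "\<bar>s\<bar> \<ge> A" for s
    proof (cases "\<bar>s\<bar> \<le> S")
      case True
      then show ?thesis using near[OF that] mult_right_mono[of "min \<kappa>1 (g s0)" "g s0" "\<bar>s\<bar> powr m"] by auto
    next
      case False
      then show ?thesis using far[of s] mult_right_mono[of "min \<kappa>1 (g s0)" "\<kappa>1" "\<bar>s\<bar> powr m"] by auto
    qed
  qed
qed

section \<open>The barrier on an annulus\<close>

text \<open>The profile from which the barrier on an annulus is built: \<open>y\<close> runs over \<open>(-1, 1)\<close> across the
  annulus, and \<open>blowup\<close> is infinite at both ends.\<close>

definition blowup :: "real \<Rightarrow> real" where "blowup y = inverse (1 - y\<^sup>2)"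

lemma blowup_ge_1: "\<bar>y\<bar> < 1 \<Longrightarrow> blowup y \<ge> 1"
  by (simp add: blowup_def abs_square_less_1 one_le_inverse_iff)

lemma blowup_has_derivative:
  assumes "\<bar>y\<bar> < 1"
  shows "(blowup has_real_derivative 2 * y * blowup y ^ 2) (at y)"
proof -
  have "1 - y\<^sup>2 \<noteq> 0" using assms by (metis abs_square_less_1 less_irrefl diff_eq_eq add_0)
  then show ?thesis unfolding blowup_def
    by (auto intro!: derivative_eq_intros simp: power2_eq_square divide_inverse)
qed

text \<open>The barrier has slope \<open>- q + t\<close> with \<open>t = A y blowup(y)^(N + 1)\<close> on an annulus of half-width
  \<open>\<delta> s\<close>. The left-hand side bounds the linear terms that \<open>t\<close> adds to the operator: its
  derivative and the term \<open>k t / r\<close> from curvature and drift, where \<open>r \<ge> s / 2\<close>.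
  All of them are at most a constant times \<open>A blowup(y)^(N + 2) / s\<close>. In the
  middle of the annulus the profile is bounded and a small \<open>A\<close> makes this at most \<open>\<epsilon> / s\<close>. Near the
  boundary \<open>|t|\<close> is bounded below, and the gap in Young's inequality, of order
  \<open>blowup(y)^((N + 1) m)\<close>, absorbs it for large \<open>s\<close> as soon as \<open>(N + 1) (m - 1) \<ge> 1\<close>.\<close>

lemma barrier_excess_small:
  fixes m q k \<epsilon> \<delta> :: real
  assumes m: "m > 1" and q: "q > 0" and k: "k \<ge> 0" and \<epsilon>: "\<epsilon> > 0" and \<delta>: "\<delta> > 0"
  obtains N :: nat and A T :: real where "N \<ge> 1" "A > 0" "T > 0"
    "\<And>s y. s \<ge> T \<Longrightarrow> \<bar>y\<bar> < 1 \<Longrightarrow>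
       A / (\<delta> * s) * (blowup y ^ (N + 1) + 2 * real (N + 1) * y\<^sup>2 * blowup y ^ (N + 2))
         + 2 * k / s * \<bar>A * y * blowup y ^ (N + 1)\<bar>
       \<le> \<epsilon> / s + young_gap m q (q - A * y * blowup y ^ (N + 1))"
proof -
  obtain N0 :: nat where N0: "real N0 > 1 / (m - 1)" using reals_Archimedean2 by blast
  define N where "N = Suc N0"
  have "1 \<le> real N0 * (m - 1)" using N0 m by (simp add: field_simps)
  also have "\<dots> \<le> real (N + 1) * (m - 1)" using m by (intro mult_right_mono) (auto simp: N_def)
  finally have N: "real (N + 2) \<le> real (N + 1) * m" by (simp add: algebra_simps)
  define E where "E = (1 + 2 * real (N + 1)) / \<delta> + 2 * k"
  have E: "E > 0" using \<delta> k by (auto simp: E_def intro!: add_pos_nonneg divide_pos_pos)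
  define A where "A = \<epsilon> / (E * (4 / 3) ^ (N + 2))"
  have A: "A > 0" using \<epsilon> E by (simp add: A_def)
  obtain \<kappa> where \<kappa>: "\<kappa> > 0"
    "\<And>s. \<bar>s\<bar> \<ge> A / 2 \<Longrightarrow> \<kappa> * \<bar>s\<bar> powr m \<le> young_gap m q (q + s)"
    using young_gap_coercive[OF m q, of "A / 2"] A by auto
  define T where "T = A * E / (\<kappa> * (A / 2) powr m)"
  have T: "T > 0" using A E \<kappa> by (simp add: T_def)
  show ?thesis
  proof
    show "N \<ge> 1" "A > 0" "T > 0" using A T by (auto simp: N_def)
    fix s y :: real assume s: "s \<ge> T" and y: "\<bar>y\<bar> < 1"
    define w where "w = blowup y"
    define t where "t = A * y * w ^ (N + 1)"
    have s0: "s > 0" using s T by simp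
    have w: "w \<ge> 1" using blowup_ge_1[OF y] by (simp add: w_def)
    have y2: "y\<^sup>2 \<le> 1" using y by (simp add: abs_square_le_1)
    have wN: "w ^ (N + 1) \<le> w ^ (N + 2)" using w by (intro power_increasing) auto
    have t: "\<bar>t\<bar> = A * \<bar>y\<bar> * w ^ (N + 1)" using A w by (simp add: t_def abs_mult)
    have "A * \<bar>y\<bar> * w ^ (N + 1) \<le> A * 1 * w ^ (N + 2)"
      using wN A y w by (intro mult_mono mult_left_mono) auto
    then have t_le: "\<bar>t\<bar> \<le> A * w ^ (N + 2)" by (simp add: t)
    have "w ^ (N + 1) + 2 * real (N + 1) * y\<^sup>2 * w ^ (N + 2)
        \<le> w ^ (N + 2) + 2 * real (N + 1) * 1 * w ^ (N + 2)"
      using wN y2 w by (intro add_mono mult_right_mono mult_left_mono) auto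
    then have "A / (\<delta> * s) * (w ^ (N + 1) + 2 * real (N + 1) * y\<^sup>2 * w ^ (N + 2))
        \<le> A / (\<delta> * s) * (w ^ (N + 2) + 2 * real (N + 1) * 1 * w ^ (N + 2))"
      using A \<delta> s0 by (intro mult_left_mono) auto
    moreover have "2 * k / s * \<bar>t\<bar> \<le> 2 * k / s * (A * w ^ (N + 2))"
      using t_le k s0 by (intro mult_left_mono) auto
    ultimately have "A / (\<delta> * s) * (w ^ (N + 1) + 2 * real (N + 1) * y\<^sup>2 * w ^ (N + 2)) + 2 * k / s * \<bar>t\<bar>
        \<le> A / (\<delta> * s) * (w ^ (N + 2) + 2 * real (N + 1) * 1 * w ^ (N + 2)) + 2 * k / s * (A * w ^ (N + 2))"
      by (rule add_mono)
    also have "\<dots> = A * E * w ^ (N + 2) / s"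
    proof -
      have "A / (\<delta> * s) * (W + 2 * n * 1 * W) + 2 * k / s * (A * W)
          = A * ((1 + 2 * n) / \<delta> + 2 * k) * W / s" for W n
        using \<delta> s0 by (simp add: field_simps)
      then show ?thesis unfolding E_def .
    qed
    also have "\<dots> \<le> \<epsilon> / s + young_gap m q (q - t)"
    proof (cases "\<bar>y\<bar> \<le> 1 / 2")
      case True
      have "y\<^sup>2 \<le> 1 / 4" using power_mono[OF True, of 2] by (simp add: power2_eq_square)
      then have "w \<le> 4 / 3" by (simp add: w_def blowup_def field_simps)
      then have "w ^ (N + 2) \<le> (4 / 3) ^ (N + 2)" using w by (intro power_mono) auto
      then have "A * E * w ^ (N + 2) \<le> A * E * (4 / 3) ^ (N + 2)"
        using A E by (intro mult_left_mono) auto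
      also have "\<dots> = \<epsilon>" using E by (simp add: A_def)
      finally show ?thesis
        using young_gap_nonneg[OF m q, of "q - t"] s0 by (smt (verit) divide_right_mono)
    next
      case False
      have "A / 2 * w ^ (N + 1) \<le> A * \<bar>y\<bar> * w ^ (N + 1)"
        using False A w by (intro mult_right_mono) auto
      then have t_ge: "A / 2 * w ^ (N + 1) \<le> \<bar>t\<bar>" by (simp add: t)
      have "A / 2 * 1 \<le> A / 2 * w ^ (N + 1)"
        using A w by (intro mult_left_mono one_le_power) auto
      then have t_ge': "A / 2 \<le> \<bar>- t\<bar>" using t_ge by simp
      have "A * E \<le> \<kappa> * (A / 2) powr m * s"
        using s \<kappa> A by (simp add: T_def pos_divide_le_eq mult.commute)
      then have "A * E * w ^ (N + 2) / s \<le> \<kappa> * (A / 2) powr m * w ^ (N + 2)"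
        using s0 w by (simp add: pos_divide_le_eq mult_right_mono mult.assoc mult.left_commute[of s] mult.commute[of s])
      also have "\<dots> \<le> \<kappa> * (A / 2) powr m * (w ^ (N + 1)) powr m"
      proof (rule mult_left_mono)
        have "w ^ (N + 2) \<le> w powr (real (N + 1) * m)"
          using w powr_mono[OF N w] powr_realpow[of w "N + 2"] by simp
        also have "\<dots> = (w ^ (N + 1)) powr m"
          using w powr_powr[of w "real (N + 1)" m] powr_realpow[of w "N + 1"] by simp
        finally show "w ^ (N + 2) \<le> (w ^ (N + 1)) powr m" .
      qed (use \<kappa> in simp)
      also have "\<kappa> * (A / 2) powr m * (w ^ (N + 1)) powr m = \<kappa> * (A / 2 * w ^ (N + 1)) powr m"
        by (subst powr_mult) (use A w in auto)
      also have "\<dots> \<le> \<kappa> * \<bar>- t\<bar> powr m"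
        using t_ge A w m \<kappa> by (intro mult_left_mono powr_mono2) auto
      also have "\<dots> \<le> young_gap m q (q + - t)" by (rule \<kappa>(2)[OF t_ge'])
      finally show ?thesis using \<epsilon> s0 by (simp add: add_increasing)
    qed
    finally show "A / (\<delta> * s) * (blowup y ^ (N + 1) + 2 * real (N + 1) * y\<^sup>2 * blowup y ^ (N + 2))
         + 2 * k / s * \<bar>A * y * blowup y ^ (N + 1)\<bar>
       \<le> \<epsilon> / s + young_gap m q (q - A * y * blowup y ^ (N + 1))"
      by (simp only: t_def w_def)
  qed
qed

text \<open>The factor \<open>A L / (2 N)\<close> normalises the barrier so that its slope is exactly
  \<open>A y blowup(y)^(N + 1) - q\<close>. A positive exponent \<open>N\<close> makes the barrier itself, not only its slope,
  infinite on the boundary.\<close>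

lemma radial_barrier:
  fixes c L q A :: real
  assumes L: "L > 0" and A: "A > 0" and N: "N \<ge> 1"
  defines "y \<equiv> \<lambda>r. (r - c) / L"
  defines "f \<equiv> \<lambda>r. A * L / (2 * real N) * blowup (y r) ^ N - q * r"
  defines "f1 \<equiv> \<lambda>r. A * y r * blowup (y r) ^ (N + 1) - q"
  defines "f2 \<equiv> \<lambda>r. A / L * (blowup (y r) ^ (N + 1) + 2 * real (N + 1) * (y r)\<^sup>2 * blowup (y r) ^ (N + 2))"
  shows "\<And>r. c - L < r \<Longrightarrow> r < c + L \<Longrightarrow> (f has_real_derivative f1 r) (at r)"
    and "\<And>r. c - L < r \<Longrightarrow> r < c + L \<Longrightarrow> (f1 has_real_derivative f2 r) (at r)"
    and "filterlim f at_top (at_right (c - L))"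
    and "filterlim f at_top (at_left (c + L))"
proof -
  have y1: "\<bar>y r\<bar> < 1" if "c - L < r" "r < c + L" for r
    using that L by (auto simp: y_def abs_less_iff field_simps)
  have dy: "(y has_real_derivative 1 / L) (at r)" for r
    unfolding y_def using L by (auto intro!: derivative_eq_intros)
  have db: "((\<lambda>r. blowup (y r)) has_real_derivative 2 * y r * blowup (y r) ^ 2 / L) (at r)"
    if "c - L < r" "r < c + L" for r
    using DERIV_chain2[OF blowup_has_derivative[OF y1[OF that]] dy] by simp
  have dp: "((\<lambda>r. blowup (y r) ^ M) has_real_derivative 2 * real M * y r * blowup (y r) ^ (M + 1) / L) (at r)"
    if "M \<ge> 1" "c - L < r" "r < c + L" for M r
  proof -
    obtain n where n: "M = Suc n" using \<open>M \<ge> 1\<close> by (cases M) auto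
    show ?thesis
      by (rule DERIV_cong[OF DERIV_power[OF db[OF that(2,3)]]])
        (simp add: n power2_eq_square field_simps)
  qed
  show "(f has_real_derivative f1 r) (at r)" if "c - L < r" "r < c + L" for r
    unfolding f_def f1_def
    by (rule DERIV_cong[OF DERIV_diff[OF DERIV_cmult[OF dp[OF N that]] DERIV_cmult_Id]])
      (use L N in \<open>simp add: field_simps\<close>)
  show "(f1 has_real_derivative f2 r) (at r)" if "c - L < r" "r < c + L" for r
    unfolding f1_def f2_def
    by (rule DERIV_cong[OF DERIV_diff[OF DERIV_mult[OF DERIV_cmult[OF dy] dp[OF _ that]] DERIV_const]])
      (use L in \<open>auto simp: field_simps power2_eq_square\<close>)
  have blow_up: "filterlim f at_top F"
    if F: "F \<le> at e" and "\<bar>y e\<bar> = 1" and ev: "eventually (\<lambda>r. c - L < r \<and> r < c + L) F" for F e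
  proof -
    have lim: "(y \<longlongrightarrow> y e) F" "((\<lambda>r. r) \<longlongrightarrow> e) F"
      using DERIV_isCont[OF dy, of e] F unfolding isCont_def by (auto intro: tendsto_mono)
    have "((\<lambda>r. 1 - (y r)\<^sup>2) \<longlongrightarrow> 1 - (y e)\<^sup>2) F" by (intro tendsto_intros lim)
    moreover have "(y e)\<^sup>2 = 1" using \<open>\<bar>y e\<bar> = 1\<close> by (metis power2_abs power_one)
    moreover have "eventually (\<lambda>r. 0 < 1 - (y r)\<^sup>2) F"
      using ev by eventually_elim (use y1 in \<open>simp add: abs_square_less_1\<close>)
    ultimately have "filterlim (\<lambda>r. blowup (y r)) at_top F"
      unfolding blowup_def by (intro filterlim_inverse_at_top) auto
    then have "filterlim (\<lambda>r. blowup (y r) ^ N) at_top F"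
      using N by (intro filterlim_pow_at_top) auto
    then have "filterlim (\<lambda>r. A * L / (2 * real N) * blowup (y r) ^ N) at_top F"
      using A L N by (intro filterlim_tendsto_pos_mult_at_top[OF tendsto_const]) auto
    then have "filterlim (\<lambda>r. - (q * r) + A * L / (2 * real N) * blowup (y r) ^ N) at_top F"
      by (intro filterlim_tendsto_add_at_top[of _ "- (q * e)"] tendsto_intros lim)
    then show ?thesis by (simp add: f_def)
  qed
  have right: "eventually (\<lambda>r. c - L < r \<and> r < c + L) (at_right (c - L))"
    using eventually_at_right_real[of "c - L" "c + L"] L by simp
  show "filterlim f at_top (at_right (c - L))"
    by (rule blow_up[of _ "c - L", OF _ _ right]) (use L in \<open>auto simp: y_def at_within_le_nhds intro: at_le\<close>)
  have left: "eventually (\<lambda>r. c - L < r \<and> r < c + L) (at_left (c + L))"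
    using eventually_at_left_real[of "c - L" "c + L"] L by simp
  show "filterlim f at_top (at_left (c + L))"
    by (rule blow_up[of _ "c + L", OF _ _ left]) (use L in \<open>auto simp: y_def intro: at_le\<close>)
qed

section \<open>Upper bound for the eigenvalue\<close>

text \<open>With the coupling constant \<open>\<beta> = (K / \<eta>) s powr (\<eta> - 1)\<close> the function
  \<open>r \<mapsto> K / r - \<beta> r powr (- \<eta>)\<close> is maximal at \<open>r = s\<close>, with value \<open>K (1 - 1 / \<eta>) / s\<close>. In the scaled
  variable \<open>u = r / s\<close> it is \<open>(K / s) h(u)\<close> with a fixed continuous \<open>h\<close>, so on a thin annulus around
  the sphere of radius \<open>s\<close> it stays within \<open>\<epsilon> / s\<close> of the maximum. The barrier on that annulus costs
  only another \<open>\<epsilon> / s\<close>.\<close>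

lemma eigenvalue_upper_bound:
  fixes b :: "'a::euclidean_space \<Rightarrow> 'a" and V :: "'a \<Rightarrow> real"
    and m q R a \<eta> \<epsilon> :: real
  defines "\<rho> \<equiv> q powr (m - 1)" and "K \<equiv> q * (real DIM('a) - 1 - a)"
  assumes m: "m > 1" and q: "q > 0" and \<eta>: "\<eta> > 1" and a: "a < real DIM('a) - 1"
    and b: "\<And>x. x \<notin> ball 0 R \<Longrightarrow> b x = ((\<rho> + a / norm x) / norm x) *\<^sub>R x"
    and V: "\<And>x. x \<notin> ball 0 R \<Longrightarrow> V x = norm x powr (- \<eta>)"
    and \<epsilon>: "\<epsilon> > 0"
  shows "eventually (\<lambda>s. \<forall>l \<phi>. EP_subsolution m b V (K / \<eta> * s powr (\<eta> - 1)) l \<phi> \<longrightarrow>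
    l \<le> q powr m * (1 - 1 / m) - (K * (1 - 1 / \<eta>) - \<epsilon>) / s) at_top"
proof -
  define k where "k = real DIM('a) - 1 - a"
  have k: "k > 0" using a by (simp add: k_def)
  have K: "K = q * k" "K > 0" using q k by (auto simp: K_def k_def)
  define e where "e = \<epsilon> / (1 + K)"
  have e: "e > 0" using \<epsilon> K by (simp add: e_def)
  define h where "h = (\<lambda>u::real. 1 / u - u powr (- \<eta>) / \<eta>)"
  have "isCont h 1" unfolding h_def using \<eta> by (intro continuous_intros) auto
  then obtain \<delta>0 where \<delta>0: "\<delta>0 > 0" "\<And>u. \<bar>u - 1\<bar> < \<delta>0 \<Longrightarrow> \<bar>h u - h 1\<bar> < e"
    using e unfolding continuous_at_eps_delta by (metis dist_real_def)
  define \<delta> where "\<delta> = min \<delta>0 (1 / 2)"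
  have \<delta>: "\<delta> > 0" "\<delta> \<le> \<delta>0" "\<delta> \<le> 1 / 2" using \<delta>0 by (auto simp: \<delta>_def)
  obtain N :: nat and A T where N: "N \<ge> 1" and A: "A > 0" and T: "T > 0"
    and excess: "\<And>s y. s \<ge> T \<Longrightarrow> \<bar>y\<bar> < 1 \<Longrightarrow>
       A / (\<delta> * s) * (blowup y ^ (N + 1) + 2 * real (N + 1) * y\<^sup>2 * blowup y ^ (N + 2))
         + 2 * k / s * \<bar>A * y * blowup y ^ (N + 1)\<bar>
       \<le> e / s + young_gap m q (q - A * y * blowup y ^ (N + 1))"
    using barrier_excess_small[OF m q less_imp_le[OF k] e \<delta>(1)] by metis
  show ?thesis
    unfolding eventually_at_top_linorder
  proof (intro exI allI impI)
    fix s l \<phi>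
    assume s: "max T (2 * \<bar>R\<bar>) \<le> s" and sub: "EP_subsolution m b V (K / \<eta> * s powr (\<eta> - 1)) l \<phi>"
    have s0: "s > 0" using s T by simp
    \<comment> \<open>\<open>s \<ge> 2 |R|\<close> keeps the annulus, whose inner radius is at least \<open>s / 2\<close>, outside the ball of radius \<open>R\<close>\<close>
    define L where "L = \<delta> * s"
    have L: "L > 0" "L \<le> s / 2"
      using \<delta> s0 mult_right_mono[OF \<delta>(3), of s] by (auto simp: L_def)
    note bar = radial_barrier[where c=s and q=q, OF L(1) A N]
    have pre: "0 \<le> s - L" "s - L < s + L" using L s0 by auto
    obtain x where x: "s - L < norm x" "norm x < s + L" and l:
      "l \<le> A / L * (blowup ((norm x - s) / L) ^ (N + 1)
            + 2 * real (N + 1) * ((norm x - s) / L)\<^sup>2 * blowup ((norm x - s) / L) ^ (N + 2))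
        + (real DIM('a) - 1) * (A * ((norm x - s) / L) * blowup ((norm x - s) / L) ^ (N + 1) - q) / norm x
        - b x \<bullet> (((A * ((norm x - s) / L) * blowup ((norm x - s) / L) ^ (N + 1) - q) / norm x) *\<^sub>R x)
        - \<bar>A * ((norm x - s) / L) * blowup ((norm x - s) / L) ^ (N + 1) - q\<bar> powr m / m
        + (K / \<eta> * s powr (\<eta> - 1)) * V x"
      by (rule subsolution_le_radial_barrier[OF sub pre bar]; (assumption | erule (2) that))
    define r where "r = norm x"
    define y where "y = (r - s) / L"
    define t where "t = A * y * blowup y ^ (N + 1)"
    define f2 where "f2 = A / (\<delta> * s) * (blowup y ^ (N + 1) + 2 * real (N + 1) * y\<^sup>2 * blowup y ^ (N + 2))"
    have y: "\<bar>y\<bar> < 1" using x L by (auto simp: y_def r_def abs_less_iff field_simps)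
    have r: "r \<ge> s / 2" "r > 0" "r \<ge> R" using x L s s0 by (auto simp: r_def)
    have xR: "x \<notin> ball 0 R" using r by (simp add: r_def)
    have "b x \<bullet> (((t - q) / r) *\<^sub>R x) = ((\<rho> + a / r) / r * ((t - q) / r)) * (x \<bullet> x)"
      by (simp add: b[OF xR] r_def)
    also have "x \<bullet> x = r\<^sup>2" by (simp add: r_def dot_square_norm)
    finally have bx: "b x \<bullet> (((t - q) / r) *\<^sub>R x) = (\<rho> + a / r) * (t - q)"
      using r by (simp add: power2_eq_square)
    define u where "u = r / s"
    have u: "u > 0" "r = s * u" using r s0 by (auto simp: u_def)
    have "u - 1 = \<delta> * y" using s0 L \<delta> by (simp add: u_def y_def L_def field_simps)
    then have "\<bar>u - 1\<bar> = \<delta> * \<bar>y\<bar>" using \<delta> by (simp add: abs_mult)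
    also have "\<dots> < \<delta> * 1" using y \<delta> by (intro mult_strict_left_mono) auto
    finally have "\<bar>u - 1\<bar> < \<delta>0" using \<delta> by simp
    moreover have "h 1 = 1 - 1 / \<eta>" by (simp add: h_def)
    ultimately have hu: "h u \<ge> 1 - 1 / \<eta> - e" using \<delta>0(2)[of u] by linarith
    have "(K / \<eta> * s powr (\<eta> - 1)) * V x = K / \<eta> * s powr (\<eta> - 1) * (s powr (- \<eta>) * u powr (- \<eta>))"
      using u s0 by (simp add: V[OF xR] r_def[symmetric] powr_mult)
    also have "\<dots> = K / \<eta> * (s powr (\<eta> - 1) * s powr (- \<eta>)) * u powr (- \<eta>)" by simp
    also have "s powr (\<eta> - 1) * s powr (- \<eta>) = 1 / s"
      using s0 by (simp add: powr_diff powr_minus_divide)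
    finally have Vx: "(K / \<eta> * s powr (\<eta> - 1)) * V x = K / s * (u powr (- \<eta>) / \<eta>)" by simp
    have gap: "\<bar>t - q\<bar> powr m / m = young_gap m q (q - t) - \<rho> * (t - q) - q powr m * (1 - 1 / m)"
      by (simp add: young_gap_def \<rho>_def algebra_simps abs_minus_commute)
    have "l \<le> f2 + (real DIM('a) - 1) * (t - q) / r - (\<rho> + a / r) * (t - q)
        - \<bar>t - q\<bar> powr m / m + K / s * (u powr (- \<eta>) / \<eta>)"
      using l unfolding r_def[symmetric] y_def[symmetric] t_def[symmetric] bx Vx
      by (simp add: f2_def L_def)
    moreover have "(real DIM('a) - 1) * (t - q) / r - (\<rho> + a / r) * (t - q) = k * t / r - K / r - \<rho> * (t - q)"
      using r by (simp add: K(1) k_def field_simps)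
    moreover have "K / r - K / s * (u powr (- \<eta>) / \<eta>) = K / s * h u"
      using u(2) by (simp add: h_def right_diff_distrib)
    moreover have "f2 + k * t / r - young_gap m q (q - t) \<le> e / s"
    proof -
      have "k * t / r \<le> k * \<bar>t\<bar> / (s / 2)"
        using k r s0 by (intro frac_le mult_left_mono) auto
      then have "k * t / r \<le> 2 * k / s * \<bar>t\<bar>" by (simp add: mult_ac)
      moreover have "f2 + 2 * k / s * \<bar>t\<bar> \<le> e / s + young_gap m q (q - t)"
        unfolding f2_def t_def by (rule excess[OF _ y]) (use s in simp)
      ultimately show ?thesis by linarith
    qed
    moreover have "K / s * (1 - 1 / \<eta> - e) \<le> K / s * h u"
      using hu K s0 by (intro mult_left_mono) auto
    ultimately have "l \<le> q powr m * (1 - 1 / m) + e / s - K / s * (1 - 1 / \<eta> - e)"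
      using gap by linarith
    also have "\<dots> = q powr m * (1 - 1 / m) - (K * (1 - 1 / \<eta>) - e * (1 + K)) / s"
      using s0 by (simp add: field_simps)
    also have "e * (1 + K) = \<epsilon>" using K by (simp add: e_def)
    finally show "l \<le> q powr m * (1 - 1 / m) - (K * (1 - 1 / \<eta>) - \<epsilon>) / s" .
  qed
qed

section \<open>Explicit subsolutions\<close>

lemma smoothed_cone_derivatives:
  fixes q :: real
  defines "\<phi> \<equiv> \<lambda>x::'a::euclidean_space. - q * (1 + x \<bullet> x) powr (1 / 2)"
    and "\<sigma> \<equiv> \<lambda>x::'a. sqrt (1 + x \<bullet> x)"
  shows "C_k 3 \<phi>"
    and "gradient \<phi> x = - (q / \<sigma> x) *\<^sub>R x"
    and "laplacian \<phi> x = - (q * (real DIM('a) - 1) / \<sigma> x) - q / \<sigma> x ^ 3"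
proof -
  define G where "G = (\<lambda>y::'a. (- q * (1 + y \<bullet> y) powr (- 1 / 2)) *\<^sub>R y)"
  define G' where "G' = (\<lambda>x h::'a. (- q * (1 + x \<bullet> x) powr (- 1 / 2)) *\<^sub>R h
      + (q * (1 + x \<bullet> x) powr (- 3 / 2) * (x \<bullet> h)) *\<^sub>R x)"
  note bracket = has_derivative_japanese_bracket_powr
  have \<sigma>: "\<sigma> x > 0" "(\<sigma> x)\<^sup>2 = 1 + x \<bullet> x" for x
    using japanese_bracket_pos[of x] by (auto simp: \<sigma>_def)
  have powr_\<sigma>: "(1 + x \<bullet> x) powr (- 1 / 2) = 1 / \<sigma> x" "(1 + x \<bullet> x) powr (- 3 / 2) = 1 / \<sigma> x ^ 3"
    for x :: 'a
  proof -
    have "(1 + x \<bullet> x) powr e = \<sigma> x powr (2 * e)" for e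
      using \<sigma>[of x] powr_powr[of "\<sigma> x" 2 e] by simp
    from this[of "- 1 / 2"] this[of "- 3 / 2"] show "(1 + x \<bullet> x) powr (- 1 / 2) = 1 / \<sigma> x"
      "(1 + x \<bullet> x) powr (- 3 / 2) = 1 / \<sigma> x ^ 3"
      using \<sigma>(1)[of x] by (simp_all add: powr_minus_divide)
  qed
  show "C_k 3 \<phi>"
    unfolding \<phi>_def by (intro C_k_mult C_k_const C_k_japanese_bracket_powr)
  have d1: "(\<phi> has_derivative (\<lambda>h. G y \<bullet> h)) (at y)" for y
    unfolding \<phi>_def
    by (rule has_derivative_eq_rhs[OF has_derivative_mult_right[OF bracket]]) (auto simp: G_def fun_eq_iff)
  have d2: "(G has_derivative G' x) (at x)" for x
    unfolding G_def
    by (rule has_derivative_eq_rhs[OF has_derivative_scaleR[OF has_derivative_mult_right[OF bracket] has_derivative_ident]])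
      (auto simp: G'_def fun_eq_iff mult_ac)
  show "gradient \<phi> x = - (q / \<sigma> x) *\<^sub>R x"
    using gradient_eq[OF d1] powr_\<sigma>(1)[of x] by (simp add: G_def)
  have "laplacian \<phi> x = (\<Sum>i\<in>Basis. G' x i \<bullet> i)" by (rule laplacian_eq[OF d1 d2])
  also have "\<dots> = - (q * real DIM('a) / \<sigma> x) + q / \<sigma> x ^ 3 * (\<Sum>i\<in>Basis. (x \<bullet> i) * (x \<bullet> i))"
    unfolding G'_def powr_\<sigma> by (simp add: inner_add_left inner_diff_left sum.distrib sum_subtractf sum_distrib_left mult.assoc)
  also have "(\<Sum>i\<in>Basis. (x \<bullet> i) * (x \<bullet> i)) = (\<sigma> x)\<^sup>2 - 1"
    unfolding euclidean_inner[symmetric] by (simp add: \<sigma>(2))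
  also have "- (q * real DIM('a) / \<sigma> x) + q / \<sigma> x ^ 3 * ((\<sigma> x)\<^sup>2 - 1)
      = - (q * (real DIM('a) - 1) / \<sigma> x) - q / \<sigma> x ^ 3"
    using \<sigma>(1)[of x] by (simp add: field_simps power2_eq_square power3_eq_cube)
  finally show "laplacian \<phi> x = - (q * (real DIM('a) - 1) / \<sigma> x) - q / \<sigma> x ^ 3" .
qed

text \<open>Bernoulli's inequality for \<open>s / r\<close> is the statement that \<open>r = s\<close> maximises the left-hand side.\<close>

lemma potential_balance:
  fixes K \<eta> s r :: real
  assumes "\<eta> > 1" "s > 0" "r > 0" "K \<ge> 0"
  shows "K / r - K / \<eta> * s powr (\<eta> - 1) * r powr (- \<eta>) \<le> K * (1 - 1 / \<eta>) / s"
proof -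
  have "1 + \<eta> * (s / r - 1) \<le> (s / r) powr \<eta>" using assms by (intro bernoulli_powr) auto
  then have "(1 + \<eta> * (s / r - 1)) / \<eta> \<le> (s / r) powr \<eta> / \<eta>"
    using assms by (intro divide_right_mono) auto
  moreover have "(1 + \<eta> * (s / r - 1)) / \<eta> = 1 / \<eta> + (s / r - 1)"
    using assms by (simp add: add_divide_distrib)
  ultimately have "s / r - (s / r) powr \<eta> / \<eta> \<le> 1 - 1 / \<eta>" by simp
  then have "K / s * (s / r - (s / r) powr \<eta> / \<eta>) \<le> K / s * (1 - 1 / \<eta>)"
    using assms by (intro mult_left_mono) auto
  moreover have "(s / r) powr \<eta> / s = s powr (\<eta> - 1) * r powr (- \<eta>)"
    using assms by (simp add: powr_divide powr_diff powr_minus_divide)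
  then have "K / s * (s / r - (s / r) powr \<eta> / \<eta>) = K / r - K / \<eta> * s powr (\<eta> - 1) * r powr (- \<eta>)"
    using assms by (simp add: right_diff_distrib) (simp add: field_simps)
  ultimately show ?thesis by simp
qed

text \<open>The smooth function \<open>- q sqrt (1 + |x|^2)\<close> has nearly the optimal slope \<open>- q\<close>. For large \<open>|x|\<close> the
  errors, from the slope and from the curvature, are of order \<open>1 / |x|^2\<close> and hence at most
  \<open>\<epsilon> / |x|\<close>; this turns \<open>K\<close> into \<open>K + \<epsilon>\<close>. On a fixed ball the other terms are bounded and \<open>V\<close> is
  bounded below by a positive constant, so a large coupling constant settles the inequality there.\<close>

lemma subsolution_exists:
  fixes b :: "'a::euclidean_space \<Rightarrow> 'a" and V :: "'a \<Rightarrow> real"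
    and m q R a \<eta> \<epsilon> :: real
  defines "\<rho> \<equiv> q powr (m - 1)" and "K \<equiv> q * (real DIM('a) - 1 - a)"
  assumes m: "m > 1" and q: "q > 0" and \<eta>: "\<eta> > 1" and a: "a < real DIM('a) - 1" and R: "R > 0"
    and b: "\<And>x. x \<notin> ball 0 R \<Longrightarrow> b x = ((\<rho> + a / norm x) / norm x) *\<^sub>R x"
    and V: "\<And>x. x \<notin> ball 0 R \<Longrightarrow> V x = norm x powr (- \<eta>)"
    and Vpos: "\<And>x. x \<in> cball 0 R \<Longrightarrow> V x > 0"
    and contb: "continuous_on UNIV b" and contV: "continuous_on UNIV V"
    and \<epsilon>: "\<epsilon> > 0"
  shows "eventually (\<lambda>s. \<exists>\<phi>. EP_subsolution m b V ((K + \<epsilon>) / \<eta> * s powr (\<eta> - 1))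
    (q powr m * (1 - 1 / m) - (K + \<epsilon>) * (1 - 1 / \<eta>) / s) \<phi>) at_top"
proof -
  define k where "k = real DIM('a) - 1 - a"
  have k: "k > 0" using a by (simp add: k_def)
  have K: "K = q * k" "K > 0" using q k by (auto simp: K_def k_def)
  have \<rho>: "\<rho> > 0" "q powr m = q * \<rho>" using q by (auto simp: \<rho>_def powr_diff)
  define C where "C = q powr m * (1 - 1 / m)"
  define \<phi> where "\<phi> = (\<lambda>x::'a. - q * (1 + x \<bullet> x) powr (1 / 2))"
  define \<sigma> where "\<sigma> = (\<lambda>x::'a. sqrt (1 + x \<bullet> x))"
  have smooth: "C_k 3 \<phi>" "gradient \<phi> x = - (q / \<sigma> x) *\<^sub>R x"
    "laplacian \<phi> x = - (q * (real DIM('a) - 1) / \<sigma> x) - q / \<sigma> x ^ 3" for x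
    unfolding \<phi>_def \<sigma>_def by (rule smoothed_cone_derivatives)+
  have \<sigma>: "\<sigma> x \<ge> 1" "\<sigma> x \<ge> norm x" "(\<sigma> x)\<^sup>2 = 1 + (norm x)\<^sup>2" for x
    by (auto simp: \<sigma>_def dot_square_norm intro: real_le_rsqrt)
  have grad: "norm (gradient \<phi> x) = q * norm x / \<sigma> x" for x
    using \<sigma>(1)[of x] q by (simp add: smooth)
  have grad_le: "norm (gradient \<phi> x) powr m / m \<le> q powr m / m" for x
  proof -
    have "q * norm x / \<sigma> x \<le> q"
      using \<sigma>(1,2)[of x] q by (simp add: pos_divide_le_eq)
    then show ?thesis
      unfolding grad using m q \<sigma>(1)[of x] by (intro divide_right_mono powr_mono2) auto
  qed
  define r0 where "r0 = max R (q * (1 + \<rho>) / \<epsilon>)"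
  have r0: "r0 \<ge> R" "r0 > 0" "\<epsilon> * r0 \<ge> q * (1 + \<rho>)"
    using R \<epsilon> mult_left_mono[OF max.cobounded2[of "q * (1 + \<rho>) / \<epsilon>" R], of \<epsilon>]
    by (auto simp: r0_def)
  obtain x0 where "x0 \<in> cball (0::'a) r0" and x0: "\<And>x. x \<in> cball 0 r0 \<Longrightarrow> V x0 \<le> V x"
    using continuous_attains_inf[OF compact_cball _ continuous_on_subset[OF contV subset_UNIV], of 0 r0] r0
    by force
  have "V x0 > 0"
    using Vpos[of x0] V[of x0] R by (cases "norm x0 \<le> R") auto
  obtain x1 where "x1 \<in> cball (0::'a) r0" and x1: "\<And>x. x \<in> cball 0 r0 \<Longrightarrow> norm (b x) \<le> norm (b x1)"
    using continuous_attains_sup[OF compact_cball _ continuous_on_norm[OF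
      continuous_on_subset[OF contb subset_UNIV]], of 0 r0] r0 by force
  define M where "M = C + q * real DIM('a) + norm (b x1) * q + q powr m / m"
  have "filterlim (\<lambda>s. s powr (\<eta> - 1)) at_top at_top"
    using \<eta> by (intro real_powr_at_top) simp
  then have "filterlim (\<lambda>s. (K + \<epsilon>) / \<eta> * s powr (\<eta> - 1)) at_top at_top"
    using K \<epsilon> \<eta> by (intro filterlim_tendsto_pos_mult_at_top[OF tendsto_const]) auto
  then have "eventually (\<lambda>s. (K + \<epsilon>) / \<eta> * s powr (\<eta> - 1) \<ge> M / V x0) at_top"
    by (simp add: filterlim_at_top)
  then show ?thesis
    using eventually_gt_at_top[of 0]
  proof eventually_elim
    case (elim s)
    define \<beta> where "\<beta> = (K + \<epsilon>) / \<eta> * s powr (\<eta> - 1)"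
    define l where "l = C - (K + \<epsilon>) * (1 - 1 / \<eta>) / s"
    have \<beta>: "\<beta> \<ge> 0" using K \<epsilon> \<eta> by (simp add: \<beta>_def)
    have l: "l \<le> C" using K \<epsilon> \<eta> elim by (simp add: l_def)
    have "EP_lhs m b V \<beta> l \<phi> x \<le> 0" for x
    proof (cases "norm x \<le> r0")
      case True
      have "- laplacian \<phi> x \<le> q * (real DIM('a) - 1) + q"
      proof -
        have "real DIM('a) \<ge> 1" using DIM_ge_Suc0[where 'a='a] by simp
        then have "q * (real DIM('a) - 1) / \<sigma> x \<le> q * (real DIM('a) - 1) / 1"
          using \<sigma>(1)[of x] q by (intro divide_left_mono) auto
        moreover have "q / \<sigma> x ^ 3 \<le> q / 1"
          using \<sigma>(1)[of x] q by (intro divide_left_mono) auto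
        ultimately show ?thesis by (simp add: smooth)
      qed
      moreover have "b x \<bullet> gradient \<phi> x \<le> norm (b x1) * q"
      proof -
        have "b x \<bullet> gradient \<phi> x \<le> norm (b x) * norm (gradient \<phi> x)" by (rule norm_cauchy_schwarz)
        also have "\<dots> \<le> norm (b x1) * q"
          using x1[of x] True \<sigma>(1,2)[of x] q unfolding grad
          by (intro mult_mono) (auto simp: pos_divide_le_eq)
        finally show ?thesis .
      qed
      moreover have "\<beta> * V x \<ge> M"
      proof -
        have "M \<le> \<beta> * V x0"
          using elim(1) \<open>V x0 > 0\<close> by (simp add: \<beta>_def pos_divide_le_eq)
        also have "\<dots> \<le> \<beta> * V x" using x0[of x] True \<beta> by (intro mult_left_mono) auto
        finally show ?thesis .
      qed
      ultimately show ?thesis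
        using l grad_le[of x] unfolding EP_lhs_def M_def by (simp add: algebra_simps)
    next
      case False
      define r where "r = norm x"
      have r: "r > r0" "r > 0" "r \<ge> R" using False r0 by (auto simp: r_def)
      have xR: "x \<notin> ball 0 R" using r by (simp add: r_def)
      have "(\<sigma> x)\<^sup>2 \<ge> r\<^sup>2" using \<sigma>(3)[of x] by (simp add: r_def)
      have inv: "1 / \<sigma> x \<le> 1 / r" using \<sigma>(1,2)[of x] r by (simp add: r_def frac_le)
      have inv3: "1 / \<sigma> x ^ 3 \<le> 1 / r\<^sup>2"
      proof (rule divide_left_mono)
        have "r\<^sup>2 * 1 \<le> (\<sigma> x)\<^sup>2 * \<sigma> x"
          using \<sigma>(1)[of x] \<open>(\<sigma> x)\<^sup>2 \<ge> r\<^sup>2\<close> by (intro mult_mono) auto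
        then show "r\<^sup>2 \<le> \<sigma> x ^ 3" by (simp add: power2_eq_square power3_eq_cube)
      qed (use r \<sigma>(1)[of x] in auto)
      have slope: "1 - r / \<sigma> x \<le> 1 / r\<^sup>2"
      proof -
        have "r / \<sigma> x \<ge> (r / \<sigma> x)\<^sup>2"
          using \<sigma>(1,2)[of x] r mult_left_mono[of "r / \<sigma> x" 1 "r / \<sigma> x"]
          by (simp add: power2_eq_square r_def del: times_divide_times_eq)
        also have "(r / \<sigma> x)\<^sup>2 = 1 - 1 / (\<sigma> x)\<^sup>2"
        proof -
          have "r\<^sup>2 = (\<sigma> x)\<^sup>2 - 1" by (simp add: \<sigma>(3) r_def)
          then show ?thesis using \<sigma>(1)[of x] by (simp add: power_divide diff_divide_distrib)
        qed
        finally have "1 - r / \<sigma> x \<le> 1 / (\<sigma> x)\<^sup>2" by simp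
        also have "\<dots> \<le> 1 / r\<^sup>2" using \<open>(\<sigma> x)\<^sup>2 \<ge> r\<^sup>2\<close> r by (intro frac_le) auto
        finally show ?thesis .
      qed
      have "b x \<bullet> gradient \<phi> x = - ((\<rho> + a / r) / r * (q / \<sigma> x)) * (x \<bullet> x)"
        by (simp add: b[OF xR] smooth r_def mult_ac)
      also have "x \<bullet> x = r\<^sup>2" by (simp add: r_def dot_square_norm)
      also have "- ((\<rho> + a / r) / r * (q / \<sigma> x)) * r\<^sup>2 = - (\<rho> * q * (r / \<sigma> x)) - a * q / \<sigma> x"
        using r \<sigma>(1)[of x] by (simp add: power2_eq_square field_simps)
      finally have bx: "b x \<bullet> gradient \<phi> x = - (\<rho> * q * (r / \<sigma> x)) - a * q / \<sigma> x" .
      have "EP_lhs m b V \<beta> l \<phi> x \<le> l + q * (real DIM('a) - 1) / \<sigma> x + q / \<sigma> x ^ 3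
          - \<rho> * q * (r / \<sigma> x) - a * q / \<sigma> x + q powr m / m - \<beta> * r powr (- \<eta>)"
        using grad_le[of x] unfolding EP_lhs_def bx smooth(3) V[OF xR] r_def[symmetric] by simp
      also have "\<dots> = l - C + K * (1 / \<sigma> x) + q * (1 / \<sigma> x ^ 3) + \<rho> * q * (1 - r / \<sigma> x) - \<beta> * r powr (- \<eta>)"
        using \<sigma>(1)[of x] m by (simp add: C_def K k_def \<rho>(2) field_simps)
      also have "\<dots> \<le> l - C + K * (1 / r) + q * (1 / r\<^sup>2) + \<rho> * q * (1 / r\<^sup>2) - \<beta> * r powr (- \<eta>)"
        using inv inv3 slope K q \<rho> \<beta> by (intro add_mono diff_mono mult_left_mono) auto
      also have "\<dots> = l - C + K / r + (q * (1 + \<rho>) / r) / r - \<beta> * r powr (- \<eta>)"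
        using r by (simp add: field_simps power2_eq_square)
      finally have "EP_lhs m b V \<beta> l \<phi> x \<le> l - C + K / r + (q * (1 + \<rho>) / r) / r - \<beta> * r powr (- \<eta>)" .
      moreover have "(q * (1 + \<rho>) / r) / r \<le> \<epsilon> / r"
      proof (rule divide_right_mono)
        have "\<epsilon> * r0 \<le> \<epsilon> * r" using r \<epsilon> by (intro mult_left_mono) auto
        with r0(3) show "q * (1 + \<rho>) / r \<le> \<epsilon>" using r by (simp add: pos_divide_le_eq)
      qed (use r in simp)
      moreover have "(K + \<epsilon>) / r - \<beta> * r powr (- \<eta>) \<le> C - l"
        using potential_balance[OF \<eta> _ r(2), of s "K + \<epsilon>"] elim K \<epsilon> by (simp add: \<beta>_def l_def)
      ultimately show ?thesis by (simp add: add_divide_distrib)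
    qed
    then have "EP_subsolution m b V \<beta> l \<phi>" using smooth(1) by (simp add: EP_subsolution_def)
    then show ?case unfolding \<beta>_def l_def C_def by blast
  qed
qed

section \<open>The limit\<close>

theorem theorem5p1:
  fixes b :: "'a::euclidean_space \<Rightarrow> 'a" and V :: "'a \<Rightarrow> real"
    and m mstar \<rho> R a \<eta> :: real
  assumes "m > 1" and "mstar = m / (m - 1)"
    and "\<rho> > 0" and "R > 0" and "\<eta> > 0"
    and "C_k 2 b" and "C_k 2 V" and "L_infinity (gradient V)"
    and "\<And>x. x \<notin> ball 0 R \<Longrightarrow> b x = ((\<rho> + a / norm x) / norm x) *\<^sub>R x"
    and "\<And>x. V x \<ge> 0"
    and "\<And>x. x \<in> cball 0 R \<Longrightarrow> V x > 0"
    and "\<And>x. x \<notin> ball 0 R \<Longrightarrow> V x = norm x powr (- \<eta>)"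
    and "\<eta> > 1" and "a < real DIM('a) - 1"
  shows "((\<lambda>\<beta>. \<beta> powr (1 / (\<eta> - 1)) * (\<rho> powr mstar / mstar - lambda_max m b V \<beta>))
    \<longlongrightarrow> (\<eta> - 1) * ((\<rho> powr (mstar - 1) / \<eta>) * (real DIM('a) - 1 - a)) powr (\<eta> / (\<eta> - 1)))
    at_top"
proof -
  note m = assms(1) and \<eta> = assms(13) and a = assms(14)
  define q where "q = \<rho> powr (mstar - 1)"
  define K where "K = q * (real DIM('a) - 1 - a)"
  define C where "C = q powr m * (1 - 1 / m)"
  define S where "S = (\<lambda>J \<beta>. (\<eta> * \<beta> / J) powr (1 / (\<eta> - 1)))"
  have q: "q > 0" using assms by (simp add: q_def)
  have K: "K > 0" using q a by (simp add: K_def)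
  \<comment> \<open>\<open>q\<close> is the minimiser of \<open>p powr m / m - \<rho> p\<close>, the slope at which the far field is in balance\<close>
  have conj: "(mstar - 1) * (m - 1) = 1" "(mstar - 1) * m = mstar" "1 / mstar = 1 - 1 / m"
    using m by (auto simp: assms(2) field_simps)
  have \<rho>: "q powr (m - 1) = \<rho>" using assms(3) by (simp add: q_def powr_powr conj)
  have C: "\<rho> powr mstar / mstar = C"
  proof -
    have "\<rho> powr mstar / mstar = \<rho> powr mstar * (1 / mstar)" by simp
    then show ?thesis unfolding conj(3) by (simp add: C_def q_def powr_powr conj(2))
  qed
  have S_at_top: "filterlim (S J) at_top at_top" if "J > 0" for J
  proof -
    have "filterlim (\<lambda>\<beta>. \<eta> / J * \<beta>) at_top at_top"
      using that \<eta> by (intro filterlim_tendsto_pos_mult_at_top[OF tendsto_const]) (auto simp: filterlim_ident)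
    then show ?thesis
      unfolding S_def using filterlim_compose[OF real_powr_at_top, of "1 / (\<eta> - 1)"] \<eta> by auto
  qed
  have S_inverse: "J / \<eta> * S J \<beta> powr (\<eta> - 1) = \<beta>" if "J > 0" "\<beta> > 0" for J \<beta>
    using that \<eta> by (simp add: S_def powr_powr)
  have S_scale: "\<beta> powr (1 / (\<eta> - 1)) * (c / S J \<beta>) = (J / \<eta>) powr (1 / (\<eta> - 1)) * c"
    if "J > 0" "\<beta> > 0" for J \<beta> c
    using that \<eta> by (simp add: S_def powr_divide powr_mult)
  define A where "A = (\<lambda>J. (J / \<eta>) powr (1 / (\<eta> - 1)) * (J * (1 - 1 / \<eta>)))"
  define f where "f = (\<lambda>\<beta>. \<beta> powr (1 / (\<eta> - 1)) * (C - lambda_max m b V \<beta>))"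
  have "continuous_on UNIV b" "continuous_on UNIV V"
    using assms(6,7)[unfolded numeral_2_eq_2, THEN C_k_SucD, THEN C_k_SucD] by simp_all
  note cont = this
  have lower: "eventually (\<lambda>s. \<exists>\<phi>. EP_subsolution m b V ((K + \<epsilon>) / \<eta> * s powr (\<eta> - 1))
      (C - (K + \<epsilon>) * (1 - 1 / \<eta>) / s) \<phi>) at_top" if "\<epsilon> > 0" for \<epsilon>
    unfolding K_def C_def
    by (rule subsolution_exists[OF m q \<eta> a assms(4) _ _ _ cont that]; (unfold \<rho>)?; erule assms(9,11,12))
  have upper: "eventually (\<lambda>s. \<forall>l \<phi>. EP_subsolution m b V (K / \<eta> * s powr (\<eta> - 1)) l \<phi> \<longrightarrow>
      l \<le> C - (K * (1 - 1 / \<eta>) - \<epsilon>) / s) at_top" if "\<epsilon> > 0" for \<epsilon>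
    unfolding K_def C_def
    by (rule eigenvalue_upper_bound[OF m q \<eta> a _ _ that]; (unfold \<rho>)?; erule assms(9,12))
  \<comment> \<open>the radius \<open>S K \<beta>\<close> inverts \<open>\<beta> = (K / \<eta>) s powr (\<eta> - 1)\<close>; the lower bound for the eigenvalue uses \<open>K + \<epsilon>\<close>\<close>
  have both: "eventually (\<lambda>\<beta>. (K / \<eta>) powr (1 / (\<eta> - 1)) * (K * (1 - 1 / \<eta>) - \<epsilon>) \<le> f \<beta> \<and> f \<beta> \<le> A (K + \<epsilon>)) at_top"
    if \<epsilon>: "\<epsilon> > 0" for \<epsilon>
  proof -
    have K\<epsilon>: "K + \<epsilon> > 0" using K \<epsilon> by simp
    show ?thesis
      using eventually_compose_filterlim[OF lower[OF \<epsilon>] S_at_top[OF K\<epsilon>]]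
        eventually_compose_filterlim[OF upper[OF \<epsilon>] S_at_top[OF K]] eventually_gt_at_top[of 0]
    proof eventually_elim
      case (elim \<beta>)
      note \<beta> = elim(3)
      let ?\<Lambda> = "{l. \<exists>\<phi>. EP_subsolution m b V \<beta> l \<phi>}"
      let ?u = "C - (K * (1 - 1 / \<eta>) - \<epsilon>) / S K \<beta>" and ?l = "C - (K + \<epsilon>) * (1 - 1 / \<eta>) / S (K + \<epsilon>) \<beta>"
      have u: "l \<le> ?u" if "l \<in> ?\<Lambda>" for l
        using elim(2) that unfolding S_inverse[OF K \<beta>] by blast
      have l: "?l \<in> ?\<Lambda>"
        using elim(1) unfolding S_inverse[OF K\<epsilon> \<beta>] by blast
      have "lambda_max m b V \<beta> \<le> ?u"
        unfolding lambda_max_def using l by (intro cSup_least u) auto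
      moreover have "?l \<le> lambda_max m b V \<beta>"
        unfolding lambda_max_def using l by (rule cSup_upper) (use u in \<open>auto intro!: bdd_aboveI\<close>)
      ultimately have "(K * (1 - 1 / \<eta>) - \<epsilon>) / S K \<beta> \<le> C - lambda_max m b V \<beta>"
        "C - lambda_max m b V \<beta> \<le> (K + \<epsilon>) * (1 - 1 / \<eta>) / S (K + \<epsilon>) \<beta>" by simp_all
      then show ?case
        using S_scale[OF K \<beta>, of "K * (1 - 1 / \<eta>) - \<epsilon>"] S_scale[OF K\<epsilon> \<beta>, of "(K + \<epsilon>) * (1 - 1 / \<eta>)"]
          mult_left_mono[of _ _ "\<beta> powr (1 / (\<eta> - 1))"]
        unfolding f_def A_def by (metis powr_ge_zero)
    qed
  qed
  have "(f \<longlongrightarrow> A K) at_top"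
  proof (rule order_tendstoI)
    fix c assume c: "c < A K"
    have "((\<lambda>\<epsilon>. (K / \<eta>) powr (1 / (\<eta> - 1)) * (K * (1 - 1 / \<eta>) - \<epsilon>))
        \<longlongrightarrow> (K / \<eta>) powr (1 / (\<eta> - 1)) * (K * (1 - 1 / \<eta>) - 0)) (at_right 0)"
      by (intro tendsto_intros)
    then have "eventually (\<lambda>\<epsilon>. c < (K / \<eta>) powr (1 / (\<eta> - 1)) * (K * (1 - 1 / \<eta>) - \<epsilon>)) (at_right 0)"
      using c by (intro order_tendstoD) (auto simp: A_def)
    then obtain \<epsilon> where "\<epsilon> > 0" "c < (K / \<eta>) powr (1 / (\<eta> - 1)) * (K * (1 - 1 / \<eta>) - \<epsilon>)"
      using eventually_happens'[OF trivial_limit_at_right_real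
        eventually_conj[OF _ eventually_at_right_less[of "0::real"]]] by blast
    then show "eventually (\<lambda>\<beta>. c < f \<beta>) at_top"
      using both[of \<epsilon>] by (auto elim: eventually_mono)
  next
    fix c assume c: "A K < c"
    have "((\<lambda>\<epsilon>. A (K + \<epsilon>)) \<longlongrightarrow> A (K + 0)) (at_right 0)"
      unfolding A_def using K \<eta> by (intro tendsto_intros) auto
    then have "eventually (\<lambda>\<epsilon>. A (K + \<epsilon>) < c) (at_right 0)"
      using c by (intro order_tendstoD) auto
    then obtain \<epsilon> where "\<epsilon> > 0" "A (K + \<epsilon>) < c"
      using eventually_happens'[OF trivial_limit_at_right_real
        eventually_conj[OF _ eventually_at_right_less[of "0::real"]]] by blast
    then show "eventually (\<lambda>\<beta>. f \<beta> < c) at_top"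
      using both[of \<epsilon>] by (auto elim: eventually_mono)
  qed
  moreover have "A K = (\<eta> - 1) * (K / \<eta>) powr (\<eta> / (\<eta> - 1))"
  proof -
    have "\<eta> / (\<eta> - 1) = 1 / (\<eta> - 1) + 1" using \<eta> by (simp add: field_simps)
    then have "(K / \<eta>) powr (\<eta> / (\<eta> - 1)) = (K / \<eta>) powr (1 / (\<eta> - 1)) * (K / \<eta>)"
      using K \<eta> by (simp add: powr_add)
    then show ?thesis using \<eta> by (simp add: A_def field_simps)
  qed
  ultimately show ?thesis
    unfolding f_def C[symmetric] K_def q_def by simp
qed

end
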